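(* Let $A$ and $B$ be strictly positive operators on a Hilbert space $H$ such that $uA\le B\le vA$ for real numbers $u,v>0$, and let $p,q\in(0,1)$ with $p\le q$. If $v\le 1$, then $$\frac{A\nabla_pB-A\sharp_pB}{p(1-p)}\ \ge\ \frac{A\nabla_qB-A\sharp_qB}{q(1-q)}.$$ If $u\ge1$, then the reverse inequality holds, i.e. $$\frac{A\nabla_pB-A\sharp_pB}{p(1-p)}\ \le\ \frac{A\nabla_qB-A\sharp_qB}{q(1-q)}.$$
   Context: An operator $A\in B(H)$ (bounded linear operators on a Hilbert space $H$) is strictly positive, $A>0$, if $A\ge 0$ and $A$ is invertible. For self-adjoint $X,Y$, $X\le Y$ means $Y-X$ is positive semidefinite. For $A,B>0$ and $p\in[0,1]$: the $p$-weighted arithmetic operator mean is $A\nabla_pB=(1-p)A+pB$, and the $p$-weighted geometric operator mean is $A\sharp_pB=A^{1/2}(A^{-1/2}BA^{-1/2})^pA^{1/2}$. *)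

theory Defs
  imports "HOL-Analysis.Analysis" "HOL-Computational_Algebra.Polynomial"
begin

section \<open>Complex Hilbert spaces\<close>

text \<open>
  The inner product \<open>cinner\<close> is linear in its first argument. Its real part is the inner product
  of the underlying real space, so norm and topology are those of \<open>real_inner\<close>.
\<close>

class complex_inner = real_inner +
  fixes scaleC :: "complex \<Rightarrow> 'a \<Rightarrow> 'a"  (infixr \<open>*\<^sub>C\<close> 75)
    and cinner :: "'a \<Rightarrow> 'a \<Rightarrow> complex"
  assumes scaleC_add_right: "a *\<^sub>C (x + y) = a *\<^sub>C x + a *\<^sub>C y"
    and scaleC_add_left: "(a + b) *\<^sub>C x = a *\<^sub>C x + b *\<^sub>C x"
    and scaleC_scaleC: "a *\<^sub>C (b *\<^sub>C x) = (a * b) *\<^sub>C x"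
    and scaleC_of_real: "complex_of_real r *\<^sub>C x = r *\<^sub>R x"
    and cinner_commute: "cinner x y = cnj (cinner y x)"
    and cinner_add_left: "cinner (x + y) z = cinner x z + cinner y z"
    and cinner_scaleC_left: "cinner (a *\<^sub>C x) y = a * cinner x y"
    and Re_cinner: "Re (cinner x y) = inner x y"

class chilbert_space = complex_inner + complete_space

instantiation complex :: chilbert_space
begin

definition "scaleC_complex (a :: complex) (x :: complex) = a * x"
definition "cinner_complex (x :: complex) (y :: complex) = x * cnj y"

instance
  by standard
    (auto simp: scaleC_complex_def cinner_complex_def algebra_simps inner_complex_def
      scaleR_conv_of_real)

end

instantiation vec :: (chilbert_space, finite) chilbert_space
begin

definition "scaleC_vec (a :: complex) (x :: 'a ^ 'b) = (\<chi> i. a *\<^sub>C (x $ i))"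
definition "cinner_vec (x :: 'a ^ 'b) (y :: 'a ^ 'b) = (\<Sum>i\<in>UNIV. cinner (x $ i) (y $ i))"

instance
proof
  fix x y :: "'a ^ 'b"
  show "cinner x y = cnj (cinner y x)"
    unfolding cinner_vec_def cnj_sum by (intro sum.cong refl cinner_commute)
qed (auto simp: scaleC_vec_def cinner_vec_def vec_eq_iff inner_vec_def scaleC_add_right
      scaleC_add_left scaleC_scaleC scaleC_of_real cinner_add_left cinner_scaleC_left
      Re_cinner sum.distrib sum_distrib_left)

end


section \<open>Bounded operators\<close>

text \<open>
  Elements of \<open>'a \<Rightarrow>\<^sub>L 'a\<close> are bounded and real-linear; \<open>B(H)\<close> is the subset of the complex-linear
  ones.
\<close>

definition BH :: "('a::complex_inner \<Rightarrow>\<^sub>L 'a) set" where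
  "BH = {T. \<forall>c x. blinfun_apply T (c *\<^sub>C x) = c *\<^sub>C blinfun_apply T x}"

definition scalar_op :: "complex \<Rightarrow> 'a::complex_inner \<Rightarrow>\<^sub>L 'a" where
  "scalar_op z = Blinfun (\<lambda>x. z *\<^sub>C x)"

lemma norm_scaleC: "norm (z *\<^sub>C x) = cmod z * norm (x :: 'a::complex_inner)"
proof -
  have sq: "cinner y y = complex_of_real ((norm y)\<^sup>2)" for y :: 'a
  proof (rule complex_eqI)
    show "Re (cinner y y) = Re (complex_of_real ((norm y)\<^sup>2))"
      by (simp add: Re_cinner power2_norm_eq_inner)
    have "Im (cinner y y) = - Im (cinner y y)"
      by (subst cinner_commute) simp
    then show "Im (cinner y y) = Im (complex_of_real ((norm y)\<^sup>2))" by simp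
  qed
  have "cinner (z *\<^sub>C x) (z *\<^sub>C x) = z * cnj (z * cinner x x)"
    by (metis cinner_scaleC_left cinner_commute)
  also have "\<dots> = (z * cnj z) * complex_of_real ((norm x)\<^sup>2)"
    by (simp add: sq)
  also have "\<dots> = complex_of_real ((cmod z * norm x)\<^sup>2)"
    by (simp add: complex_norm_square [symmetric] power_mult_distrib del: of_real_power)
  finally have "(norm (z *\<^sub>C x))\<^sup>2 = (cmod z * norm x)\<^sup>2"
    unfolding sq of_real_eq_iff .
  then show ?thesis by simp
qed

lemma scalar_op_apply [simp]:
  "blinfun_apply (scalar_op z) x = z *\<^sub>C (x :: 'a::complex_inner)"
proof -
  have "bounded_linear (\<lambda>x::'a. z *\<^sub>C x)"
  proof (rule bounded_linear_intro)
    show "z *\<^sub>C (r *\<^sub>R x) = r *\<^sub>R (z *\<^sub>C x)" for r and x :: 'a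
      by (metis scaleC_of_real scaleC_scaleC mult.commute)
    show "norm (z *\<^sub>C x) \<le> norm x * cmod z" for x :: 'a
      by (simp add: norm_scaleC)
  qed (rule scaleC_add_right)
  then show ?thesis
    by (simp add: scalar_op_def bounded_linear_Blinfun_apply)
qed

definition invertible_op :: "('a::complex_inner \<Rightarrow>\<^sub>L 'a) \<Rightarrow> bool" where
  "invertible_op T \<longleftrightarrow> (\<exists>S\<in>BH. T o\<^sub>L S = id_blinfun \<and> S o\<^sub>L T = id_blinfun)"

definition selfadjoint_op :: "('a::complex_inner \<Rightarrow>\<^sub>L 'a) \<Rightarrow> bool" where
  "selfadjoint_op T \<longleftrightarrow> T \<in> BH \<and>
     (\<forall>x y. cinner (blinfun_apply T x) y = cinner x (blinfun_apply T y))"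

text \<open>For self-adjoint \<open>T\<close> the number \<open>cinner (T x) x\<close> is real.\<close>

definition positive_op :: "('a::complex_inner \<Rightarrow>\<^sub>L 'a) \<Rightarrow> bool" where
  "positive_op T \<longleftrightarrow> selfadjoint_op T \<and> (\<forall>x. 0 \<le> Re (cinner (blinfun_apply T x) x))"

definition strictly_positive_op :: "('a::complex_inner \<Rightarrow>\<^sub>L 'a) \<Rightarrow> bool" where
  "strictly_positive_op T \<longleftrightarrow> positive_op T \<and> invertible_op T"

definition op_le :: "('a::complex_inner \<Rightarrow>\<^sub>L 'a) \<Rightarrow> ('a \<Rightarrow>\<^sub>L 'a) \<Rightarrow> bool"  (infix \<open>\<preceq>\<close> 50) where
  "X \<preceq> Y \<longleftrightarrow> selfadjoint_op X \<and> selfadjoint_op Y \<and> positive_op (Y - X)"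


section \<open>Continuous functional calculus for self-adjoint operators\<close>

definition spectrum_op :: "('a::complex_inner \<Rightarrow>\<^sub>L 'a) \<Rightarrow> complex set" where
  "spectrum_op T = {z. \<not> invertible_op (T - scalar_op z)}"

definition poly_op :: "real poly \<Rightarrow> ('a::complex_inner \<Rightarrow>\<^sub>L 'a) \<Rightarrow> ('a \<Rightarrow>\<^sub>L 'a)" where
  "poly_op P T = (\<Sum>i\<le>degree P. coeff P i *\<^sub>R (((o\<^sub>L) T) ^^ i) id_blinfun)"

text \<open>
  For self-adjoint \<open>T\<close> the spectrum is a compact subset of the real line and
  \<open>\<parallel>P(T)\<parallel> = sup {\<bar>P(x)\<bar> | x \<in> \<sigma>(T)}\<close> for real polynomials \<open>P\<close>. So, for \<open>f\<close> continuous on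
  \<open>\<sigma>(T)\<close>, the operator \<open>f(T)\<close> is the common norm limit of \<open>P\<^sub>n(T)\<close> for all sequences of
  polynomials \<open>P\<^sub>n\<close> that tend to \<open>f\<close> uniformly on \<open>\<sigma>(T)\<close>; such sequences exist by
  Weierstrass' theorem. The description is meant for self-adjoint \<open>T\<close> only.
\<close>

definition fun_op :: "(real \<Rightarrow> real) \<Rightarrow> ('a::complex_inner \<Rightarrow>\<^sub>L 'a) \<Rightarrow> ('a \<Rightarrow>\<^sub>L 'a)" where
  "fun_op f T = (THE X. \<forall>P :: nat \<Rightarrow> real poly.
     uniform_limit {x. complex_of_real x \<in> spectrum_op T} (\<lambda>n. poly (P n)) f sequentially \<longrightarrow>
     (\<lambda>n. poly_op (P n) T) \<longlonglongrightarrow> X)"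

text \<open>
  Real powers of strictly positive operators, whose spectrum lies in \<open>{0<..}\<close>, so that the value
  \<open>0 powr r = 0\<close> plays no role.
\<close>

definition powr_op :: "('a::complex_inner \<Rightarrow>\<^sub>L 'a) \<Rightarrow> real \<Rightarrow> ('a \<Rightarrow>\<^sub>L 'a)" where
  "powr_op T r = fun_op (\<lambda>x. x powr r) T"


section \<open>Weighted operator means\<close>

definition arith_mean :: "real \<Rightarrow> ('a::complex_inner \<Rightarrow>\<^sub>L 'a) \<Rightarrow> ('a \<Rightarrow>\<^sub>L 'a) \<Rightarrow> ('a \<Rightarrow>\<^sub>L 'a)" where
  "arith_mean p A B = (1 - p) *\<^sub>R A + p *\<^sub>R B"

definition geom_mean :: "real \<Rightarrow> ('a::complex_inner \<Rightarrow>\<^sub>L 'a) \<Rightarrow> ('a \<Rightarrow>\<^sub>L 'a) \<Rightarrow> ('a \<Rightarrow>\<^sub>L 'a)" where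
  "geom_mean p A B =
     powr_op A (1/2)
       o\<^sub>L powr_op (powr_op A (-1/2) o\<^sub>L B o\<^sub>L powr_op A (-1/2)) p
       o\<^sub>L powr_op A (1/2)"

end

theory Submission
  imports Defs "HOL-Computational_Algebra.Fundamental_Theorem_Algebra"
begin

text \<open>
  With \<open>C = A powr (-1/2) B A powr (-1/2)\<close>, whose spectrum lies in \<open>{u..v}\<close>, both sides have the form
  \<open>A powr (1/2) f(C) A powr (1/2)\<close> with \<open>f x = ((1 - r) + r x - x powr r) / (r (1 - r))\<close>, \<open>r \<in> {p, q}\<close>.
  So it suffices to compare the two scalar functions on \<open>{u..v}\<close>. The functional calculus rests on
  the following: a real polynomial without roots in the spectrum of a self-adjoint \<open>T\<close> is invertible
  at \<open>T\<close>, because it splits into linear factors and quadratic factors that are coercive at \<open>T\<close>; since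
  the infimum of the numerical range is a spectral value, a polynomial that is nonnegative on the
  spectrum is positive at \<open>T\<close>.
\<close>

section \<open>Self-adjoint operators\<close>

lemma Im_cinner: "Im (cinner x y) = inner (- \<i> *\<^sub>C x) y"
  by (simp flip: Re_cinner add: cinner_scaleC_left)

text \<open>By \<open>Im_cinner\<close> the imaginary part of \<open>cinner\<close> is again a real
  inner product, and complex linearity lets \<open>T\<close> pass over the scalar. From here on the
  real \<open>inner\<close> replaces \<open>cinner\<close>.\<close>

lemma selfadjoint_op_iff_inner:
  "selfadjoint_op T \<longleftrightarrow> T \<in> BH \<and> (\<forall>x y. inner (T x) y = inner x (T y))"
proof -
  have "cinner (T x) y = cinner x (T y)"
    if "T \<in> BH" and sym: "\<And>x y. inner (T x) y = inner x (T y)" for x y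
  proof (rule complex_eqI)
    show "Re (cinner (T x) y) = Re (cinner x (T y))"
      by (simp add: Re_cinner sym)
    show "Im (cinner (T x) y) = Im (cinner x (T y))"
      using \<open>T \<in> BH\<close> sym[of "- \<i> *\<^sub>C x" y] by (simp add: Im_cinner BH_def)
  qed
  then show ?thesis
    unfolding selfadjoint_op_def by (metis Re_cinner)
qed

lemma selfadjoint_op_inner: "selfadjoint_op T \<Longrightarrow> inner (T x) y = inner x (T y)"
  by (simp add: selfadjoint_op_iff_inner)

lemma selfadjoint_op_BH: "selfadjoint_op T \<Longrightarrow> T \<in> BH"
  by (simp add: selfadjoint_op_iff_inner)

lemma positive_op_iff_inner:
  "positive_op T \<longleftrightarrow> selfadjoint_op T \<and> (\<forall>x. 0 \<le> inner (T x) x)"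
  by (simp add: positive_op_def Re_cinner)

lemma scaleC_scaleR_commute: "c *\<^sub>C (r *\<^sub>R x) = r *\<^sub>R (c *\<^sub>C (x::'a::complex_inner))"
  by (metis scaleC_of_real scaleC_scaleC mult.commute)

lemma scaleC_zero [simp]: "c *\<^sub>C (0::'a::complex_inner) = 0"
  using scaleC_scaleR_commute[of c 0 0] by simp

lemma scaleC_minus: "c *\<^sub>C (- x) = - (c *\<^sub>C (x::'a::complex_inner))"
  using scaleC_scaleR_commute[of c "-1" x] by simp

lemma scaleC_diff: "c *\<^sub>C (x - y) = c *\<^sub>C x - c *\<^sub>C (y::'a::complex_inner)"
  using scaleC_add_right[of c x "- y"] by (simp add: scaleC_minus)

lemma BH_intros:
  shows "(0 :: 'a::complex_inner \<Rightarrow>\<^sub>L 'a) \<in> BH"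
    and "(id_blinfun :: 'a::complex_inner \<Rightarrow>\<^sub>L 'a) \<in> BH"
    and "S \<in> BH \<Longrightarrow> T \<in> BH \<Longrightarrow> S + T \<in> BH"
    and "S \<in> BH \<Longrightarrow> T \<in> BH \<Longrightarrow> S - T \<in> BH"
    and "S \<in> BH \<Longrightarrow> T \<in> BH \<Longrightarrow> S o\<^sub>L T \<in> BH"
    and "T \<in> BH \<Longrightarrow> r *\<^sub>R T \<in> BH"
  by (auto simp: BH_def blinfun.add_left blinfun.diff_left blinfun.scaleR_left
      scaleC_add_right scaleC_diff scaleC_scaleR_commute)

lemma selfadjoint_op_intros:
  shows "selfadjoint_op (0 :: 'a::complex_inner \<Rightarrow>\<^sub>L 'a)"
    and "selfadjoint_op (id_blinfun :: 'a::complex_inner \<Rightarrow>\<^sub>L 'a)"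
    and "selfadjoint_op S \<Longrightarrow> selfadjoint_op T \<Longrightarrow> selfadjoint_op (S + T)"
    and "selfadjoint_op S \<Longrightarrow> selfadjoint_op T \<Longrightarrow> selfadjoint_op (S - T)"
    and "selfadjoint_op T \<Longrightarrow> selfadjoint_op (r *\<^sub>R T)"
    and "selfadjoint_op S \<Longrightarrow> selfadjoint_op T \<Longrightarrow> selfadjoint_op (S o\<^sub>L T o\<^sub>L S)"
  by (auto simp: selfadjoint_op_iff_inner BH_intros blinfun.add_left blinfun.diff_left
      blinfun.scaleR_left inner_add inner_diff)

lemma scalar_op_of_real: "scalar_op (complex_of_real r) = r *\<^sub>R id_blinfun"
  by (rule blinfun_eqI) (simp add: scaleC_of_real blinfun.scaleR_left)

lemma blinfun_compose_assoc: "(S o\<^sub>L T) o\<^sub>L U = S o\<^sub>L (T o\<^sub>L U)"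
  by (rule blinfun_eqI) simp

lemma blinfun_compose_id_right: "T o\<^sub>L id_blinfun = T"
  by (rule blinfun_eqI) simp

section \<open>Invertibility, coercivity and the location of the spectrum\<close>

lemma invertible_op_compose:
  assumes "invertible_op S" "invertible_op T"
  shows "invertible_op (S o\<^sub>L T)"
proof -
  obtain S' T' where "S' \<in> BH" "S o\<^sub>L S' = id_blinfun" "S' o\<^sub>L S = id_blinfun"
    "T' \<in> BH" "T o\<^sub>L T' = id_blinfun" "T' o\<^sub>L T = id_blinfun"
    using assms unfolding invertible_op_def by blast
  then have "(S o\<^sub>L T) o\<^sub>L (T' o\<^sub>L S') = id_blinfun" "(T' o\<^sub>L S') o\<^sub>L (S o\<^sub>L T) = id_blinfun"
    by (metis blinfun_compose_assoc blinfun_compose_id_right)+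
  with \<open>S' \<in> BH\<close> \<open>T' \<in> BH\<close> show ?thesis
    unfolding invertible_op_def using BH_intros(5) by blast
qed

lemma invertible_op_scaleR_id:
  "r \<noteq> 0 \<Longrightarrow> invertible_op (r *\<^sub>R (id_blinfun :: 'a::complex_inner \<Rightarrow>\<^sub>L 'a))"
  unfolding invertible_op_def
  by (intro bexI[of _ "inverse r *\<^sub>R id_blinfun"])
     (auto intro: blinfun_eqI BH_intros simp: blinfun.scaleR_left blinfun.scaleR_right)

lemma invertible_op_uminus:
  assumes "invertible_op (- T)" shows "invertible_op (T :: 'a::complex_inner \<Rightarrow>\<^sub>L 'a)"
proof -
  have "(-1) *\<^sub>R id_blinfun o\<^sub>L (- T) = T"
    by (rule blinfun_eqI) (simp add: blinfun.scaleR_left blinfun.minus_left)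
  with invertible_op_compose[OF invertible_op_scaleR_id[of "-1"] assms] show ?thesis by simp
qed

text \<open>For large \<open>M\<close> the map \<open>x \<mapsto> x - (T x - y) / M\<close> is a contraction; its fixed point solves
  \<open>T x = y\<close>.\<close>

lemma coercive_op_surj:
  fixes T :: "'a::chilbert_space \<Rightarrow>\<^sub>L 'a"
  assumes "c > 0" and coercive: "\<And>x. c * (norm x)\<^sup>2 \<le> inner (T x) x"
  shows "\<exists>x. T x = y"
proof -
  define K where "K = norm T + c"
  \<comment> \<open>This \<open>M\<close> minimises
    \<open>1 - 2 * c / M + K\<^sup>2 / M\<^sup>2\<close>, which bounds the squared contraction
    factor; the minimum is \<open>1 - c\<^sup>2 / K\<^sup>2\<close>. The summand \<open>c\<close> in
    \<open>K\<close> ensures \<open>0 < K\<close> and \<open>c \<le> K\<close> even on the zero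
    space.\<close>
  define M where "M = K\<^sup>2 / c"
  define k where "k = sqrt (1 - c\<^sup>2 / K\<^sup>2)"
  define f where "f x = x - (1 / M) *\<^sub>R (T x - y)" for x
  have "K > 0" "c \<le> K" using \<open>c > 0\<close> by (auto simp: K_def add_nonneg_pos)
  then have M: "M > 0" using \<open>c > 0\<close> by (simp add: M_def)
  have k2: "0 \<le> 1 - c\<^sup>2 / K\<^sup>2" "1 - c\<^sup>2 / K\<^sup>2 < 1"
    using \<open>K > 0\<close> \<open>c \<le> K\<close> \<open>c > 0\<close> by (simp_all add: power_mono)
  then have k: "0 \<le> k" "k < 1" by (auto simp: k_def)
  have contr: "dist (f x) (f z) \<le> k * dist x z" for x z
  proof -
    define d where "d = x - z"
    have "f x - f z = d - (1 / M) *\<^sub>R T d"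
      by (simp add: f_def d_def blinfun.diff_right algebra_simps)
    then have "(norm (f x - f z))\<^sup>2 = (norm d)\<^sup>2 - 2 / M * inner (T d) d + (norm (T d))\<^sup>2 / M\<^sup>2"
      unfolding power2_norm_eq_inner
      by (simp add: inner_diff inner_commute[of d "T d"] power2_eq_square diff_divide_distrib)
    also have "\<dots> \<le> (norm d)\<^sup>2 - 2 / M * (c * (norm d)\<^sup>2) + (K * norm d)\<^sup>2 / M\<^sup>2"
    proof -
      have "norm (T d) \<le> K * norm d"
        using norm_blinfun[of T d] \<open>c > 0\<close> by (simp add: K_def distrib_right add_increasing2)
      then have "(norm (T d))\<^sup>2 / M\<^sup>2 \<le> (K * norm d)\<^sup>2 / M\<^sup>2"
        by (intro divide_right_mono power_mono) auto
      moreover have "2 / M * (c * (norm d)\<^sup>2) \<le> 2 / M * inner (T d) d"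
        using M by (intro mult_left_mono coercive) auto
      ultimately show ?thesis by linarith
    qed
    also have "\<dots> = (1 - c\<^sup>2 / K\<^sup>2) * (norm d)\<^sup>2"
    proof -
      have "2 / M * c = 2 * (c\<^sup>2 / K\<^sup>2)" "K\<^sup>2 / M\<^sup>2 = c\<^sup>2 / K\<^sup>2"
        using \<open>K > 0\<close> \<open>c > 0\<close> by (simp_all add: M_def power2_eq_square)
      moreover have "2 / M * (c * (norm d)\<^sup>2) = (2 / M * c) * (norm d)\<^sup>2"
        "(K * norm d)\<^sup>2 / M\<^sup>2 = K\<^sup>2 / M\<^sup>2 * (norm d)\<^sup>2"
        by (simp_all add: power_mult_distrib)
      ultimately show ?thesis by (simp only: left_diff_distrib) simp
    qed
    also have "\<dots> = (k * norm d)\<^sup>2"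
      using k2 by (simp add: k_def power_mult_distrib)
    finally have "norm (f x - f z) \<le> k * norm d"
      by (rule power2_le_imp_le) (simp add: k)
    then show ?thesis by (simp add: dist_norm d_def)
  qed
  then obtain x where "f x = x"
    using banach_fix_type[OF k, of f] by blast
  then show ?thesis using M by (auto simp: f_def)
qed

text \<open>This is the Lax--Milgram theorem. Coercivity bounds \<open>T\<close> from below, so
  \<open>T\<close> is injective and its inverse is bounded; surjectivity is
  \<open>coercive_op_surj\<close>. Injectivity also transfers complex linearity to the
  inverse.\<close>

lemma coercive_op_invertible:
  fixes T :: "'a::chilbert_space \<Rightarrow>\<^sub>L 'a"
  assumes T: "T \<in> BH" and "c > 0" and coercive: "\<And>x. c * (norm x)\<^sup>2 \<le> inner (T x) x"
  shows "invertible_op T"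
proof -
  have bound: "norm x \<le> norm (T x) * (1 / c)" for x
  proof (cases "x = 0")
    case False
    have "c * norm x * norm x \<le> norm (T x) * norm x"
      using coercive[of x] norm_cauchy_schwarz[of "T x" x] by (simp add: power2_eq_square)
    then show ?thesis using False \<open>c > 0\<close> by (simp add: field_simps)
  qed simp
  have inj: "x = y" if "T x = T y" for x y
    using bound[of "x - y"] that by (simp add: blinfun.diff_right)
  obtain g where g: "\<And>y. T (g y) = y"
    using coercive_op_surj[OF \<open>c > 0\<close> coercive] by metis
  have "bounded_linear g"
  proof (rule bounded_linear_intro)
    show "g (x + y) = g x + g y" "g (r *\<^sub>R x) = r *\<^sub>R g x" for r x y
      by (rule inj, simp add: g blinfun.add_right blinfun.scaleR_right)+
    show "norm (g x) \<le> norm x * (1 / c)" for x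
      using bound[of "g x"] by (simp add: g)
  qed
  then have G: "blinfun_apply (Blinfun g) = g"
    by (rule bounded_linear_Blinfun_apply)
  have "g (z *\<^sub>C x) = z *\<^sub>C g x" for z x
    by (rule inj) (use T in \<open>simp add: BH_def g\<close>)
  then have "Blinfun g \<in> BH"
    by (simp add: BH_def G)
  moreover have "T o\<^sub>L Blinfun g = id_blinfun"
    by (rule blinfun_eqI) (simp add: G g)
  moreover have "Blinfun g o\<^sub>L T = id_blinfun"
    by (rule blinfun_eqI, rule inj) (simp add: G g)
  ultimately show ?thesis unfolding invertible_op_def by blast
qed

text \<open>The discriminant argument for Cauchy--Schwarz, for the form \<open>(x, y) \<mapsto> inner (T x) y\<close> at \<open>x\<close> and
  \<open>T x\<close>.\<close>

lemma positive_op_norm_apply_le: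
  assumes "positive_op T"
  shows "(norm (T x))\<^sup>2 \<le> norm T * inner (T x) x"
proof -
  define a where "a = (norm (T x))\<^sup>2"
  have sa: "selfadjoint_op T" and pos: "\<And>x. 0 \<le> inner (T x) x"
    using assms by (auto simp: positive_op_iff_inner)
  have quad: "0 \<le> inner (T x) x - 2 * t * a + t\<^sup>2 * (norm T * a)" for t
  proof -
    have "0 \<le> inner (T (x - t *\<^sub>R T x)) (x - t *\<^sub>R T x)" by (rule pos)
    also have "\<dots> = inner (T x) x - 2 * t * a + t\<^sup>2 * inner (T (T x)) (T x)"
      using selfadjoint_op_inner[OF sa, of "T x" x] unfolding a_def power2_norm_eq_inner
      by (simp add: blinfun.diff_right blinfun.scaleR_right inner_diff_left inner_diff_right
          power2_eq_square algebra_simps)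
    also have "inner (T (T x)) (T x) \<le> norm T * a"
    proof -
      have "inner (T (T x)) (T x) \<le> norm (T (T x)) * norm (T x)"
        by (rule norm_cauchy_schwarz)
      also have "\<dots> \<le> norm T * norm (T x) * norm (T x)"
        by (intro mult_right_mono norm_blinfun) simp
      finally show ?thesis by (simp add: a_def power2_eq_square)
    qed
    finally show ?thesis by (simp add: mult_left_mono)
  qed
  show ?thesis
  proof (cases "norm T = 0")
    case True
    then show ?thesis by simp
  next
    case False
    then have "norm T > 0" by simp
    \<comment> \<open>The choice \<open>t = 1 / norm T\<close> minimises the quadratic and leaves
      \<open>0 \<le> inner (T x) x - a / norm T\<close>.\<close>
    then show ?thesis
      using quad[of "1 / norm T"] by (simp add: a_def field_simps power2_eq_square)
  qed
qed

text \<open>A bounded inverse \<open>S\<close> controls \<open>norm x\<close> by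
  \<open>norm (T x)\<close>, and \<open>positive_op_norm_apply_le\<close> controls the latter by the
  quadratic form.\<close>

lemma strictly_positive_op_coercive:
  assumes "strictly_positive_op T"
  obtains c where "c > 0" "\<And>x. c * (norm x)\<^sup>2 \<le> inner (T x) x"
proof -
  have pos: "positive_op T" using assms by (simp add: strictly_positive_op_def)
  obtain S where S: "S o\<^sub>L T = id_blinfun"
    using assms unfolding strictly_positive_op_def invertible_op_def by blast
  \<comment> \<open>The summand 1 keeps \<open>K\<close> positive, so that \<open>1 / K\<close> can
    serve as the coercivity constant.\<close>
  define K where "K = (norm S)\<^sup>2 * norm T + 1"
  have "K > 0" by (simp add: K_def add_nonneg_pos)
  have "(norm x)\<^sup>2 \<le> K * inner (T x) x" for x
  proof -
    have "norm x = norm (S (T x))" using arg_cong[OF S, of "\<lambda>U. blinfun_apply U x"] by simp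
    then have "(norm x)\<^sup>2 \<le> (norm S * norm (T x))\<^sup>2"
      by (simp add: norm_blinfun power_mono)
    also have "\<dots> = (norm S)\<^sup>2 * (norm (T x))\<^sup>2" by (simp add: power_mult_distrib)
    also have "\<dots> \<le> (norm S)\<^sup>2 * (norm T * inner (T x) x)"
      by (intro mult_left_mono positive_op_norm_apply_le pos) simp
    also have "\<dots> \<le> K * inner (T x) x"
      using pos by (simp add: K_def positive_op_iff_inner algebra_simps)
    finally show ?thesis .
  qed
  then have "1 / K * (norm x)\<^sup>2 \<le> inner (T x) x" for x
    using \<open>K > 0\<close> by (simp add: divide_le_eq mult.commute)
  then show ?thesis using \<open>K > 0\<close> by (intro that[of "1 / K"]) auto
qed

text \<open>For \<open>r < m\<close> the operator \<open>T - r\<close> is coercive with constant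
  \<open>m - r\<close>; for \<open>r > M\<close> its negative is coercive with constant
  \<open>r - M\<close>.\<close>

lemma spectrum_op_bounds:
  fixes T :: "'a::chilbert_space \<Rightarrow>\<^sub>L 'a"
  assumes T: "T \<in> BH" and lower: "\<And>x. m * (norm x)\<^sup>2 \<le> inner (T x) x"
    and upper: "\<And>x. inner (T x) x \<le> M * (norm x)\<^sup>2"
    and r: "complex_of_real r \<in> spectrum_op T"
  shows "r \<in> {m..M}"
proof -
  have BH: "T - scalar_op (of_real r) \<in> BH" "- (T - scalar_op (of_real r)) \<in> BH"
    using T BH_intros(6)[of "T - scalar_op (of_real r)" "-1"]
    by (auto simp: scalar_op_of_real BH_intros)
  have form: "inner ((T - scalar_op (of_real r)) x) x = inner (T x) x - r * (norm x)\<^sup>2" for x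
    by (simp add: scalar_op_of_real blinfun.diff_left blinfun.scaleR_left inner_diff
        power2_norm_eq_inner)
  have "invertible_op (T - scalar_op (of_real r))" if "r < m"
  proof (rule coercive_op_invertible[OF BH(1), of "m - r"])
    show "(m - r) * (norm x)\<^sup>2 \<le> inner ((T - scalar_op (of_real r)) x) x" for x
      unfolding form using lower[of x] by (simp add: left_diff_distrib)
  qed (use that in simp)
  moreover have "invertible_op (T - scalar_op (of_real r))" if "M < r"
  proof (rule invertible_op_uminus, rule coercive_op_invertible[OF BH(2), of "r - M"])
    show "(r - M) * (norm x)\<^sup>2 \<le> inner ((- (T - scalar_op (of_real r))) x) x" for x
      unfolding blinfun.minus_left inner_minus_left form using upper[of x]
      by (simp add: left_diff_distrib)
  qed (use that in simp)
  ultimately show ?thesis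
    using r unfolding spectrum_op_def by force
qed

section \<open>Polynomials of operators\<close>

lemma poly_op_eq_sum:
  "degree P \<le> n \<Longrightarrow> poly_op P T = (\<Sum>i\<le>n. coeff P i *\<^sub>R (((o\<^sub>L) T) ^^ i) id_blinfun)"
  unfolding poly_op_def by (intro sum.mono_neutral_left) (auto simp: coeff_eq_0)

lemma poly_op_0 [simp]: "poly_op 0 T = 0"
  by (simp add: poly_op_def)

lemma poly_op_pCons: "poly_op (pCons a P) T = a *\<^sub>R id_blinfun + (T o\<^sub>L poly_op P T)"
proof -
  \<comment> \<open>For \<open>P = 0\<close> the index bound \<open>Suc (degree P)\<close> exceeds
    the true degree; \<open>poly_op_eq_sum\<close> permits the padding by zero coefficients.\<close>
  have "poly_op (pCons a P) T = (\<Sum>i\<le>Suc (degree P). coeff (pCons a P) i *\<^sub>R (((o\<^sub>L) T) ^^ i) id_blinfun)"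
    by (rule poly_op_eq_sum) (simp add: degree_pCons_le)
  also have "\<dots> = a *\<^sub>R id_blinfun + (\<Sum>i\<le>degree P. coeff P i *\<^sub>R (T o\<^sub>L (((o\<^sub>L) T) ^^ i) id_blinfun))"
    by (simp add: sum.atMost_Suc_shift del: sum.atMost_Suc)
  also have "\<dots> = a *\<^sub>R id_blinfun + (T o\<^sub>L poly_op P T)"
    by (simp add: poly_op_def bounded_bilinear.sum_right[OF bounded_bilinear_blinfun_compose]
        bounded_bilinear.scaleR_right[OF bounded_bilinear_blinfun_compose])
  finally show ?thesis .
qed

lemma poly_op_const: "poly_op [:c:] T = c *\<^sub>R id_blinfun"
  by (simp add: poly_op_pCons)

lemma poly_op_linear: "poly_op [:c, d:] T = c *\<^sub>R id_blinfun + d *\<^sub>R T"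
  by (rule blinfun_eqI)
     (simp add: poly_op_pCons blinfun.add_left blinfun.scaleR_left blinfun.scaleR_right)

lemma poly_op_add: "poly_op (P + Q) T = poly_op P T + poly_op Q T"
proof (induction P Q rule: poly_induct2)
  case (pCons a P b Q)
  then show ?case
    by (intro blinfun_eqI)
       (simp add: poly_op_pCons blinfun.bilinear_simps algebra_simps)
qed simp

lemma poly_op_smult: "poly_op (smult c P) T = c *\<^sub>R poly_op P T"
proof (induction P)
  case (pCons a P)
  then show ?case
    by (intro blinfun_eqI)
       (simp add: poly_op_pCons blinfun.bilinear_simps algebra_simps)
qed simp

lemma poly_op_diff: "poly_op (P - Q) T = poly_op P T - poly_op Q T"
  using poly_op_add[of "P - Q" Q T] by simp

lemma poly_op_mult: "poly_op (P * Q) T = poly_op P T o\<^sub>L poly_op Q T"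
proof (induction P)
  case (pCons a P)
  have "poly_op (pCons a P * Q) T = a *\<^sub>R poly_op Q T + (T o\<^sub>L poly_op (P * Q) T)"
    by (simp add: poly_op_add poly_op_smult poly_op_pCons)
  then show ?case
    by (intro blinfun_eqI) (simp add: pCons.IH poly_op_pCons blinfun.bilinear_simps)
qed simp

lemma selfadjoint_op_compose:
  assumes "selfadjoint_op S" "selfadjoint_op T" "S o\<^sub>L T = T o\<^sub>L S"
  shows "selfadjoint_op (S o\<^sub>L T)"
proof -
  have "S (T x) = T (S x)" for x
    using arg_cong[OF assms(3), of "\<lambda>U. blinfun_apply U x"] by simp
  with assms(1,2) show ?thesis
    by (auto simp: selfadjoint_op_iff_inner BH_intros)
qed

lemma selfadjoint_op_poly_op:
  assumes "selfadjoint_op T"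
  shows "selfadjoint_op (poly_op P T)"
proof (induction P)
  case (pCons a P)
  \<comment> \<open>Both sides are the value at \<open>T\<close> of the product of \<open>P\<close>
    with the indeterminate, and polynomials commute.\<close>
  have "T o\<^sub>L poly_op P T = poly_op P T o\<^sub>L T"
    using poly_op_mult[of "[:0, 1:]" P T] poly_op_mult[of P "[:0, 1:]" T]
    by (simp add: mult.commute poly_op_linear)
  with pCons.IH assms show ?case
    by (simp add: poly_op_pCons selfadjoint_op_intros selfadjoint_op_compose)
qed (simp add: selfadjoint_op_intros)

section \<open>Factors of real polynomials and invertibility at an operator\<close>

lemma poly_map_poly_of_real_add_mult:
  fixes z :: complex
  shows "poly (map_poly of_real (P + Q)) z = poly (map_poly of_real P) z + poly (map_poly of_real Q) z"
    and "poly (map_poly of_real (P * Q)) z = poly (map_poly of_real P) z * poly (map_poly of_real Q) z"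
proof -
  show add: "poly (map_poly of_real (P + Q)) z = poly (map_poly of_real P) z + poly (map_poly of_real Q) z"
    for P Q :: "real poly"
    by (induction P Q rule: poly_induct2) (simp_all add: map_poly_pCons algebra_simps)
  have smult: "poly (map_poly of_real (smult c P)) z = of_real c * poly (map_poly of_real P) z"
    for c and P :: "real poly"
    by (induction P) (simp_all add: map_poly_pCons algebra_simps)
  show "poly (map_poly of_real (P * Q)) z = poly (map_poly of_real P) z * poly (map_poly of_real Q) z"
    by (induction P) (simp_all add: map_poly_pCons add smult algebra_simps)
qed

text \<open>A complex root \<open>z\<close> exists. If it is real, it gives the linear factor;
  otherwise divide by the real quadratic with roots \<open>z\<close> and \<open>cnj z\<close> and
  show that the remainder vanishes.\<close>

lemma real_poly_factor_linear_or_quadratic: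
  fixes Q :: "real poly"
  assumes "degree Q > 0"
  shows "(\<exists>r. [:-r, 1:] dvd Q) \<or> (\<exists>a b. b \<noteq> 0 \<and> [:a\<^sup>2 + b\<^sup>2, -2 * a, 1:] dvd Q)"
proof -
  define Qc where "Qc = map_poly complex_of_real Q"
  have "degree Qc = degree Q"
    unfolding Qc_def by (rule degree_map_poly) simp
  then have "\<not> constant (poly Qc)"
    using assms by (simp add: constant_degree)
  then obtain z where z: "poly Qc z = 0"
    using fundamental_theorem_of_algebra by blast
  show ?thesis
  proof (cases "Im z = 0")
    case True
    then have "z = of_real (Re z)" by (simp add: complex_eq_iff)
    moreover have "poly Qc (of_real r) = of_real (poly Q r)" for r
      unfolding Qc_def by (induction Q) (simp_all add: map_poly_pCons)
    ultimately have "poly Q (Re z) = 0" using z by (metis of_real_eq_0_iff)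
    then show ?thesis by (auto simp: poly_eq_0_iff_dvd)
  next
    case False
    define D where "D = [:(Re z)\<^sup>2 + (Im z)\<^sup>2, -2 * Re z, 1:]"
    have "degree D = 2" by (simp add: D_def)
    define e where "e = coeff (Q mod D) 0"
    define f where "f = coeff (Q mod D) 1"
    have "degree (Q mod D) < 2 \<or> Q mod D = 0"
      using degree_mod_less[of D Q] \<open>degree D = 2\<close> by (auto simp: D_def)
    then have R: "Q mod D = [:e, f:]"
      by (intro poly_eqI) (auto simp: e_def f_def coeff_pCons coeff_eq_0 split: nat.splits)
    have Dz: "poly (map_poly of_real D) z = 0"
      by (simp add: D_def map_poly_pCons complex_eq_iff power2_eq_square algebra_simps)
    have "poly Qc z = poly (map_poly of_real (Q div D)) z * poly (map_poly of_real D) z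
        + poly (map_poly of_real [:e, f:]) z"
      unfolding Qc_def poly_map_poly_of_real_add_mult(2)[symmetric]
        poly_map_poly_of_real_add_mult(1)[symmetric] R[symmetric]
      by simp
    then have "of_real e + z * of_real f = 0" by (simp add: z Dz map_poly_pCons)
    \<comment> \<open>Since \<open>Im z\<close> is nonzero, the imaginary part forces
      \<open>f = 0\<close>, and then the real part forces \<open>e = 0\<close>.\<close>
    then have "e = 0" "f = 0" using False by (auto simp: complex_eq_iff)
    then have "D dvd Q" using R by (simp add: mod_eq_0_iff_dvd)
    then show ?thesis using False unfolding D_def by blast
  qed
qed

text \<open>Half of the spectral mapping theorem, by splitting off one linear or quadratic factor at
  a time. Roots of the cofactor are roots of \<open>Q\<close>, so the hypothesis survives the
  induction.\<close>

lemma invertible_op_poly_op: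
  fixes T :: "'a::chilbert_space \<Rightarrow>\<^sub>L 'a"
  assumes T: "selfadjoint_op T"
  shows "Q \<noteq> 0 \<Longrightarrow> (\<And>r. complex_of_real r \<in> spectrum_op T \<Longrightarrow> poly Q r \<noteq> 0)
    \<Longrightarrow> invertible_op (poly_op Q T)"
proof (induction "degree Q" arbitrary: Q rule: less_induct)
  case less
  show ?case
  proof (cases "degree Q = 0")
    case True
    then obtain c where "Q = [:c:]" by (rule degree_eq_zeroE)
    then show ?thesis using less.prems(1) by (simp add: poly_op_const invertible_op_scaleR_id)
  next
    case False
    have step: "invertible_op (poly_op Q T)"
      if "Q = D * Q'" "degree D > 0" "invertible_op (poly_op D T)" for D Q'
    proof -
      have "Q' \<noteq> 0" "D \<noteq> 0" using that less.prems(1) by auto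
      then have "degree Q' < degree Q" using that by (simp add: degree_mult_eq)
      moreover have "poly Q' r \<noteq> 0" if "complex_of_real r \<in> spectrum_op T" for r
        using less.prems(2)[OF that] \<open>Q = D * Q'\<close> by auto
      ultimately have "invertible_op (poly_op Q' T)"
        using less.hyps \<open>Q' \<noteq> 0\<close> by blast
      then show ?thesis
        using that by (simp add: poly_op_mult invertible_op_compose)
    qed
    from False real_poly_factor_linear_or_quadratic[of Q] consider
      (linear) r where "[:-r, 1:] dvd Q"
      | (quadratic) a b where "b \<noteq> 0" "[:a\<^sup>2 + b\<^sup>2, -2 * a, 1:] dvd Q"
      by blast
    then show ?thesis
    proof cases
      case linear
      then have "complex_of_real r \<notin> spectrum_op T"
        using less.prems(2)[of r] by (auto simp: poly_eq_0_iff_dvd)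
      then have "invertible_op (T - r *\<^sub>R id_blinfun)"
        by (simp add: spectrum_op_def scalar_op_of_real)
      then have "invertible_op (poly_op [:-r, 1:] T)" by (simp add: poly_op_linear)
      moreover obtain Q' where "Q = [:-r, 1:] * Q'" using linear by (rule dvdE)
      ultimately show ?thesis by (intro step) auto
    next
      case quadratic
      let ?D = "[:a\<^sup>2 + b\<^sup>2, -2 * a, 1:]"
      define L where "L = poly_op [:-a, 1:] T"
      have L: "selfadjoint_op L" unfolding L_def by (rule selfadjoint_op_poly_op[OF T])
      \<comment> \<open>Completing the square: at \<open>T\<close> the quadratic form is that of
        \<open>L o\<^sub>L L\<close> plus \<open>b\<^sup>2 * (norm x)\<^sup>2\<close>, hence
        coercive with constant \<open>b\<^sup>2\<close>.\<close>
      have "?D = [:-a, 1:] * [:-a, 1:] + [:b\<^sup>2:]" by (simp add: power2_eq_square)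
      then have "poly_op ?D T = (L o\<^sub>L L) + b\<^sup>2 *\<^sub>R id_blinfun"
        by (simp only: poly_op_add poly_op_mult poly_op_const L_def)
      then have "inner (poly_op ?D T x) x = (norm (L x))\<^sup>2 + b\<^sup>2 * (norm x)\<^sup>2" for x
        using selfadjoint_op_inner[OF L, of "L x" x]
        by (simp add: blinfun.add_left blinfun.scaleR_left inner_add_left power2_norm_eq_inner)
      then have "invertible_op (poly_op ?D T)"
        using \<open>b \<noteq> 0\<close> selfadjoint_op_BH[OF selfadjoint_op_poly_op[OF T]]
        by (intro coercive_op_invertible[of _ "b\<^sup>2"]) auto
      moreover obtain Q' where "Q = ?D * Q'" using quadratic(2) by (rule dvdE)
      ultimately show ?thesis by (intro step[of ?D]) auto
    qed
  qed
qed

section \<open>Numerical range, positivity and the norm bound\<close>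

text \<open>Take the infimum \<open>m\<close> of the numerical range. Then \<open>S - m\<close> is
  positive; were it invertible, it would be coercive, and the lower bound could be raised.\<close>

lemma not_invertible_below_numerical_range:
  fixes S :: "'a::complex_inner \<Rightarrow>\<^sub>L 'a"
  assumes S: "selfadjoint_op S" and "x \<noteq> 0"
  obtains m where "m * (norm x)\<^sup>2 \<le> inner (S x) x" "\<not> invertible_op (S - m *\<^sub>R id_blinfun)"
proof -
  \<comment> \<open>The vector \<open>x\<close> shows that \<open>N\<close> is nonempty and
    \<open>- norm S\<close> bounds it from below, so \<open>Inf N\<close> is a genuine
    infimum.\<close>
  define N where "N = (\<lambda>z. inner (S z) z) ` sphere 0 1"
  define m where "m = Inf N"
  have form: "inner (S (z /\<^sub>R norm z)) (z /\<^sub>R norm z) = inner (S z) z / (norm z)\<^sup>2" for z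
    by (simp add: blinfun.scaleR_right power2_eq_square divide_inverse)
  have mem: "inner (S z) z / (norm z)\<^sup>2 \<in> N" if "z \<noteq> 0" for z
    unfolding form[symmetric] N_def using that by (intro imageI) simp
  have "- norm S \<le> inner (S z) z" if "norm z = 1" for z
    using Cauchy_Schwarz_ineq2[of "S z" z] norm_blinfun[of S z] that by simp
  then have "bdd_below N" unfolding N_def by (intro bdd_belowI[of _ "- norm S"]) auto
  have lower: "m * (norm z)\<^sup>2 \<le> inner (S z) z" for z
  proof (cases "z = 0")
    case False
    then show ?thesis
      using cInf_lower[OF mem[OF False] \<open>bdd_below N\<close>] by (simp add: m_def le_divide_eq)
  qed simp
  have R: "inner ((S - m *\<^sub>R id_blinfun) z) z = inner (S z) z - m * (norm z)\<^sup>2" for z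
    by (simp add: blinfun.diff_left blinfun.scaleR_left inner_diff_left power2_norm_eq_inner)
  have "\<not> invertible_op (S - m *\<^sub>R id_blinfun)"
  proof
    assume "invertible_op (S - m *\<^sub>R id_blinfun)"
    moreover have "positive_op (S - m *\<^sub>R id_blinfun)"
      unfolding positive_op_iff_inner R using lower S by (simp add: selfadjoint_op_intros)
    ultimately have "strictly_positive_op (S - m *\<^sub>R id_blinfun)"
      by (simp add: strictly_positive_op_def)
    then obtain c where "c > 0" and c: "\<And>z. c * (norm z)\<^sup>2 \<le> inner (S z) z - m * (norm z)\<^sup>2"
      using strictly_positive_op_coercive R by metis
    have "m + c \<le> inner (S z) z" if "norm z = 1" for z
      using c[of z] that by simp
    then have "m + c \<le> Inf N"
      using mem[OF \<open>x \<noteq> 0\<close>] by (intro cInf_greatest) (auto simp: N_def)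
    then show False using \<open>c > 0\<close> by (simp add: m_def)
  qed
  with lower show ?thesis using that by blast
qed

text \<open>A negative value of the form would put some \<open>m < 0\<close> into the spectrum of
  \<open>poly_op P T\<close>, although \<open>P - [:m:]\<close> is positive on the spectrum of
  \<open>T\<close>.\<close>

lemma positive_op_poly_op:
  fixes T :: "'a::chilbert_space \<Rightarrow>\<^sub>L 'a"
  assumes T: "selfadjoint_op T"
    and nonneg: "\<And>r. complex_of_real r \<in> spectrum_op T \<Longrightarrow> 0 \<le> poly P r"
  shows "positive_op (poly_op P T)"
proof (rule ccontr)
  assume "\<not> positive_op (poly_op P T)"
  then obtain x where x: "inner (poly_op P T x) x < 0"
    using selfadjoint_op_poly_op[OF T] by (auto simp: positive_op_iff_inner not_le)
  then have "x \<noteq> 0" by auto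
  obtain m where m: "m * (norm x)\<^sup>2 \<le> inner (poly_op P T x) x"
    and ninv: "\<not> invertible_op (poly_op P T - m *\<^sub>R id_blinfun)"
    using not_invertible_below_numerical_range[OF selfadjoint_op_poly_op[OF T] \<open>x \<noteq> 0\<close>] by blast
  have "m < 0" using m x by (smt (verit) mult_nonneg_nonneg zero_le_power2)
  \<comment> \<open>A spectral value of \<open>T\<close> shows that \<open>P - [:m:]\<close> is not
    the zero polynomial, as \<open>invertible_op_poly_op\<close> demands.\<close>
  obtain r where "\<not> invertible_op (T - r *\<^sub>R id_blinfun)"
    using not_invertible_below_numerical_range[OF T \<open>x \<noteq> 0\<close>] by blast
  then have "complex_of_real r \<in> spectrum_op T"
    by (simp add: spectrum_op_def scalar_op_of_real)
  then have "poly (P - [:m:]) r \<noteq> 0" using nonneg[of r] \<open>m < 0\<close> by simp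
  then have "P - [:m:] \<noteq> 0" by force
  then have "invertible_op (poly_op (P - [:m:]) T)"
    using nonneg \<open>m < 0\<close> by (intro invertible_op_poly_op[OF T]) force+
  with ninv show False by (simp add: poly_op_diff poly_op_const)
qed

text \<open>Positivity of \<open>e\<^sup>2 - P\<^sup>2\<close> gives the bound on the norm.\<close>

lemma norm_poly_op_le:
  fixes T :: "'a::chilbert_space \<Rightarrow>\<^sub>L 'a"
  assumes T: "selfadjoint_op T" and "e \<ge> 0"
    and le: "\<And>r. complex_of_real r \<in> spectrum_op T \<Longrightarrow> \<bar>poly P r\<bar> \<le> e"
  shows "norm (poly_op P T) \<le> e"
proof (rule norm_blinfun_bound[OF \<open>e \<ge> 0\<close>])
  fix x
  have "0 \<le> poly ([:e\<^sup>2:] - P * P) r" if "complex_of_real r \<in> spectrum_op T" for r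
    using abs_le_square_iff[of "poly P r" e] le[OF that] \<open>e \<ge> 0\<close> by (simp add: power2_eq_square)
  then have "positive_op (poly_op ([:e\<^sup>2:] - P * P) T)"
    by (rule positive_op_poly_op[OF T])
  then have "0 \<le> inner (poly_op ([:e\<^sup>2:] - P * P) T x) x"
    by (simp add: positive_op_iff_inner)
  also have "\<dots> = (e * norm x)\<^sup>2 - (norm (poly_op P T x))\<^sup>2"
    using selfadjoint_op_inner[OF selfadjoint_op_poly_op[OF T], of P "poly_op P T x" x]
    by (simp add: poly_op_diff poly_op_const poly_op_mult blinfun.diff_left blinfun.scaleR_left
        inner_diff_left power_mult_distrib flip: power2_norm_eq_inner)
  finally have "(norm (poly_op P T x))\<^sup>2 \<le> (e * norm x)\<^sup>2" by simp
  then show "norm (poly_op P T x) \<le> e * norm x"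
    by (rule power2_le_imp_le) (simp add: \<open>e \<ge> 0\<close>)
qed

section \<open>Functional calculus\<close>

text \<open>This makes the bounded operators a Banach space, in which Cauchy sequences of operators
  converge.\<close>

instance chilbert_space \<subseteq> banach ..

text \<open>Weierstrass' theorem in the form that \<open>fun_op\<close> asks for: a sequence of type
  \<open>real poly\<close>, with errors below \<open>1 / (n + 1)\<close>.\<close>

lemma poly_uniform_approx:
  fixes f :: "real \<Rightarrow> real"
  assumes "continuous_on {m..M} f"
  obtains P where "uniform_limit {m..M} (\<lambda>n. poly (P n)) f sequentially"
proof -
  have "\<exists>Q. \<forall>x\<in>{m..M}. \<bar>f x - poly Q x\<bar> < inverse (real (Suc n))" for n
  proof -
    obtain g where g: "real_polynomial_function g" "\<And>x. x \<in> {m..M} \<Longrightarrow> \<bar>f x - g x\<bar> < inverse (real (Suc n))"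
      using Stone_Weierstrass_real_polynomial_function[OF compact_Icc assms, of "inverse (real (Suc n))"]
      by auto
    obtain a k where "g = (\<lambda>x. \<Sum>i\<le>k. a i * x ^ i)"
      using g(1) by (auto simp: real_polynomial_function_iff_sum)
    then have "poly (\<Sum>i\<le>k. monom (a i) i) x = g x" for x
      by (simp add: poly_sum poly_monom)
    then show ?thesis using g(2) by metis
  qed
  then obtain P where P: "\<And>n x. x \<in> {m..M} \<Longrightarrow> \<bar>f x - poly (P n) x\<bar> < inverse (real (Suc n))"
    by metis
  have "uniform_limit {m..M} (\<lambda>n. poly (P n)) f sequentially"
  proof (rule uniform_limitI)
    fix e :: real assume "e > 0"
    then have "\<forall>\<^sub>F n in sequentially. inverse (real (Suc n)) < e"
      using LIMSEQ_inverse_real_of_nat by (rule order_tendstoD(2)[rotated])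
    then show "\<forall>\<^sub>F n in sequentially. \<forall>x\<in>{m..M}. dist (poly (P n) x) (f x) < e"
    proof eventually_elim
      case (elim n)
      then show ?case
        using P[of _ n] by (metis dist_real_def abs_minus_commute order_less_trans)
    qed
  qed
  then show ?thesis by (rule that)
qed

text \<open>The interval \<open>{m..M}\<close> stands in for the spectrum: it contains
  \<open>spec\<close>, it is compact, and Weierstrass approximation is available on it.\<close>

locale form_bounded_op =
  fixes T :: "'a::chilbert_space \<Rightarrow>\<^sub>L 'a" and m M :: real
  assumes selfadjoint: "selfadjoint_op T"
    and lower: "m * (norm x)\<^sup>2 \<le> inner (T x) x"
    and upper: "inner (T x) x \<le> M * (norm x)\<^sup>2"
begin

abbreviation spec :: "real set" where
  "spec \<equiv> {x. complex_of_real x \<in> spectrum_op T}"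

lemma spec_subset: "spec \<subseteq> {m..M}"
  using spectrum_op_bounds[OF selfadjoint_op_BH[OF selfadjoint] lower upper] by auto

text \<open>On the spectrum \<open>P\<close> and \<open>Q\<close> differ by at most
  \<open>e / 2\<close>, a weak bound that \<open>norm_poly_op_le\<close> transfers. This serves both
  for two members of one sequence and for two sequences with the same limit.\<close>

lemma dist_poly_op_less:
  assumes "e > 0" and "\<forall>r\<in>spec. dist (poly P r) (f r) < e / 4" "\<forall>r\<in>spec. dist (poly Q r) (f r) < e / 4"
  shows "dist (poly_op P T) (poly_op Q T) < e"
proof -
  have "norm (poly_op (P - Q) T) \<le> e / 2"
  proof (rule norm_poly_op_le[OF selfadjoint])
    fix r assume "complex_of_real r \<in> spectrum_op T"
    then have "dist (poly P r) (f r) < e / 4" "dist (poly Q r) (f r) < e / 4"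
      using assms by auto
    then show "\<bar>poly (P - Q) r\<bar> \<le> e / 2" unfolding dist_real_def poly_diff by linarith
  qed (use \<open>e > 0\<close> in simp)
  then show ?thesis using \<open>e > 0\<close> by (simp add: poly_op_diff dist_norm)
qed

lemma poly_op_diff_tendsto_0:
  assumes "uniform_limit spec (\<lambda>n. poly (P n)) f F" "uniform_limit spec (\<lambda>n. poly (Q n)) f F"
  shows "((\<lambda>n. poly_op (P n) T - poly_op (Q n) T) \<longlongrightarrow> 0) F"
proof (rule tendstoI)
  fix e :: real assume "e > 0"
  then have "e / 4 > 0" by simp
  from uniform_limitD[OF assms(1) this] uniform_limitD[OF assms(2) this]
  show "\<forall>\<^sub>F n in F. dist (poly_op (P n) T - poly_op (Q n) T) 0 < e"
  proof eventually_elim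
    case (elim n)
    then show ?case using dist_poly_op_less[OF \<open>e > 0\<close>] by (simp add: dist_norm)
  qed
qed

lemma poly_op_convergent:
  assumes P: "uniform_limit spec (\<lambda>n. poly (P n)) f sequentially"
  shows "convergent (\<lambda>n. poly_op (P n) T)"
proof -
  have "Cauchy (\<lambda>n. poly_op (P n) T)"
  proof (rule metric_CauchyI)
    fix e :: real assume "e > 0"
    then have "\<forall>\<^sub>F n in sequentially. \<forall>x\<in>spec. dist (poly (P n) x) (f x) < e / 4"
      by (intro uniform_limitD[OF P]) simp
    then obtain N where "\<forall>n\<ge>N. \<forall>x\<in>spec. dist (poly (P n) x) (f x) < e / 4"
      unfolding eventually_sequentially by blast
    then have "\<forall>i\<ge>N. \<forall>j\<ge>N. dist (poly_op (P i) T) (poly_op (P j) T) < e"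
      using dist_poly_op_less[OF \<open>e > 0\<close>] by blast
    then show "\<exists>N. \<forall>i\<ge>N. \<forall>j\<ge>N. dist (poly_op (P i) T) (poly_op (P j) T) < e" by blast
  qed
  then show ?thesis by (rule Cauchy_convergent)
qed

text \<open>This justifies the \<open>THE\<close> in \<open>fun_op\<close>: the limit along
  \<open>P\<close> is shared by all approximating sequences, and \<open>P\<close> itself determines
  it uniquely.\<close>

lemma fun_op_tendsto:
  assumes f: "continuous_on {m..M} f"
    and P: "uniform_limit spec (\<lambda>n. poly (P n)) f sequentially"
  shows "(\<lambda>n. poly_op (P n) T) \<longlonglongrightarrow> fun_op f T"
proof -
  let ?lim = "\<lambda>X. \<forall>P. uniform_limit spec (\<lambda>n. poly (P n)) f sequentially \<longrightarrow>
    (\<lambda>n. poly_op (P n) T) \<longlonglongrightarrow> X"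
  obtain X where X: "(\<lambda>n. poly_op (P n) T) \<longlonglongrightarrow> X"
    using poly_op_convergent[OF P] by (auto simp: convergent_def)
  have "?lim X"
  proof (intro allI impI)
    fix Q assume "uniform_limit spec (\<lambda>n. poly (Q n)) f sequentially"
    from tendsto_add[OF poly_op_diff_tendsto_0[OF this P] X]
    show "(\<lambda>n. poly_op (Q n) T) \<longlonglongrightarrow> X" by simp
  qed
  moreover have "Y = X" if "?lim Y" for Y
    using that P X LIMSEQ_unique by blast
  ultimately have "fun_op f T = X"
    unfolding fun_op_def by (intro the_equality)
  with X show ?thesis by simp
qed

lemma fun_op_approx:
  assumes "continuous_on {m..M} f"
  obtains P where "uniform_limit {m..M} (\<lambda>n. poly (P n)) f sequentially"
    "(\<lambda>n. poly_op (P n) T) \<longlonglongrightarrow> fun_op f T"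
  using poly_uniform_approx[OF assms] fun_op_tendsto[OF assms] uniform_limit_on_subset[OF _ spec_subset]
  by metis

lemma fun_op_eqI:
  assumes "uniform_limit {m..M} (\<lambda>n. poly (P n)) f sequentially"
    and "continuous_on {m..M} f"
    and "(\<lambda>n. poly_op (P n) T) \<longlonglongrightarrow> X"
  shows "fun_op f T = X"
  using fun_op_tendsto[OF assms(2)] uniform_limit_on_subset[OF assms(1) spec_subset] assms(3)
    LIMSEQ_unique by blast

lemma fun_op_cong:
  assumes "\<And>x. x \<in> {m..M} \<Longrightarrow> f x = g x"
  shows "fun_op f T = fun_op g T"
proof -
  have "uniform_limit spec P f sequentially \<longleftrightarrow> uniform_limit spec P g sequentially" for P
    using assms spec_subset by (intro uniform_limit_cong') auto
  then show ?thesis unfolding fun_op_def by simp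
qed

lemma fun_op_poly: "fun_op (poly Q) T = poly_op Q T"
  by (rule fun_op_eqI[where P = "\<lambda>_. Q"]) (auto simp: uniform_limit_iff intro!: continuous_intros)

lemma fun_op_diff:
  assumes f: "continuous_on {m..M} f" and g: "continuous_on {m..M} g"
  shows "fun_op (\<lambda>x. f x - g x) T = fun_op f T - fun_op g T"
proof -
  obtain P Q where P: "uniform_limit {m..M} (\<lambda>n. poly (P n)) f sequentially"
      "(\<lambda>n. poly_op (P n) T) \<longlonglongrightarrow> fun_op f T"
    and Q: "uniform_limit {m..M} (\<lambda>n. poly (Q n)) g sequentially"
      "(\<lambda>n. poly_op (Q n) T) \<longlonglongrightarrow> fun_op g T"
    using fun_op_approx[OF f] fun_op_approx[OF g] by metis
  have "poly (P n - Q n) = (\<lambda>x. poly (P n) x - poly (Q n) x)" for n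
    by (rule ext) simp
  then show ?thesis
    using uniform_limit_minus[OF P(1) Q(1)] tendsto_diff[OF P(2) Q(2)]
    by (intro fun_op_eqI[where P = "\<lambda>n. P n - Q n"])
       (auto simp: poly_op_diff intro!: continuous_intros f g)
qed

lemma fun_op_mult:
  assumes f: "continuous_on {m..M} f" and g: "continuous_on {m..M} g"
  shows "fun_op (\<lambda>x. f x * g x) T = fun_op f T o\<^sub>L fun_op g T"
proof -
  obtain P Q where P: "uniform_limit {m..M} (\<lambda>n. poly (P n)) f sequentially"
      "(\<lambda>n. poly_op (P n) T) \<longlonglongrightarrow> fun_op f T"
    and Q: "uniform_limit {m..M} (\<lambda>n. poly (Q n)) g sequentially"
      "(\<lambda>n. poly_op (Q n) T) \<longlonglongrightarrow> fun_op g T"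
    using fun_op_approx[OF f] fun_op_approx[OF g] by metis
  \<comment> \<open>Uniform convergence passes to products because the limit functions are
    bounded.\<close>
  have "bounded (f ` {m..M})" "bounded (g ` {m..M})"
    using f g by (auto intro!: compact_imp_bounded compact_continuous_image)
  then have "uniform_limit {m..M} (\<lambda>n x. poly (P n) x * poly (Q n) x) (\<lambda>x. f x * g x) sequentially"
    by (intro uniform_lim_mult P Q)
  moreover have "poly (P n * Q n) = (\<lambda>x. poly (P n) x * poly (Q n) x)" for n
    by (rule ext) simp
  ultimately show ?thesis
    using bounded_bilinear.tendsto[OF bounded_bilinear_blinfun_compose P(2) Q(2)]
    by (intro fun_op_eqI[where P = "\<lambda>n. P n * Q n"])
       (auto simp: poly_op_mult intro!: continuous_intros f g)
qed

lemma selfadjoint_op_fun_op: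
  assumes f: "continuous_on {m..M} f"
  shows "selfadjoint_op (fun_op f T)"
proof -
  obtain P where P: "(\<lambda>n. poly_op (P n) T) \<longlonglongrightarrow> fun_op f T"
    using fun_op_approx[OF f] by metis
  have lim: "(\<lambda>n. poly_op (P n) T x) \<longlonglongrightarrow> fun_op f T x" for x
    by (intro blinfun.tendsto P tendsto_const)
  have sa: "selfadjoint_op (poly_op (P n) T)" for n
    by (rule selfadjoint_op_poly_op[OF selfadjoint])
  show ?thesis
    unfolding selfadjoint_op_iff_inner BH_def mem_Collect_eq
  proof (intro conjI allI)
    fix c x
    \<comment> \<open>Writing the complex scaling as the bounded operator \<open>scalar_op c\<close>
      provides its continuity.\<close>
    have "(\<lambda>n. scalar_op c (poly_op (P n) T x)) \<longlonglongrightarrow> scalar_op c (fun_op f T x)"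
      by (intro blinfun.tendsto lim tendsto_const)
    moreover have "poly_op (P n) T (c *\<^sub>C x) = c *\<^sub>C poly_op (P n) T x" for n
      using selfadjoint_op_BH[OF sa] by (simp add: BH_def)
    ultimately show "fun_op f T (c *\<^sub>C x) = c *\<^sub>C fun_op f T x"
      using lim[of "c *\<^sub>C x"] LIMSEQ_unique by simp
  next
    fix x y
    have "(\<lambda>n. inner (poly_op (P n) T x) y) \<longlonglongrightarrow> inner (fun_op f T x) y"
      "(\<lambda>n. inner x (poly_op (P n) T y)) \<longlonglongrightarrow> inner x (fun_op f T y)"
      by (intro tendsto_inner lim tendsto_const)+
    then show "inner (fun_op f T x) y = inner x (fun_op f T y)"
      unfolding selfadjoint_op_inner[OF sa] using LIMSEQ_unique by blast
  qed
qed

text \<open>The operator is the square of the self-adjoint operator obtained from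
  \<open>sqrt (f x)\<close>.\<close>

lemma positive_op_fun_op:
  assumes f: "continuous_on {m..M} f" and nonneg: "\<And>x. x \<in> {m..M} \<Longrightarrow> 0 \<le> f x"
  shows "positive_op (fun_op f T)"
proof -
  let ?g = "\<lambda>x. sqrt (f x)"
  have g: "continuous_on {m..M} ?g" by (intro continuous_intros f)
  have "fun_op (\<lambda>x. ?g x * ?g x) T = fun_op ?g T o\<^sub>L fun_op ?g T"
    by (rule fun_op_mult[OF g g])
  moreover have "fun_op (\<lambda>x. ?g x * ?g x) T = fun_op f T"
    by (rule fun_op_cong) (simp add: nonneg)
  ultimately have "fun_op f T x = fun_op ?g T (fun_op ?g T x)" for x
    by (metis blinfun_apply_blinfun_compose)
  then have "inner (fun_op f T x) x = (norm (fun_op ?g T x))\<^sup>2" for x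
    by (simp add: selfadjoint_op_inner[OF selfadjoint_op_fun_op[OF g]] power2_norm_eq_inner)
  then show ?thesis
    using selfadjoint_op_fun_op[OF f] by (simp add: positive_op_iff_inner)
qed

end

section \<open>Weighted means\<close>

definition mean_gap :: "real \<Rightarrow> real \<Rightarrow> real" where
  "mean_gap r x = ((1 - r) + r * x - x powr r) / (r * (1 - r))"

text \<open>Up to a positive factor the difference is \<open>D\<close> below, where \<open>D 1 = 0\<close> and \<open>D' \<ge> 0\<close> by the
  weighted arithmetic-geometric mean inequality for \<open>x powr (p - 1)\<close> and \<open>1\<close>.\<close>

lemma mean_gap_mono:
  assumes pq: "0 < p" "p \<le> q" "q < 1"
  shows "x \<ge> 1 \<Longrightarrow> mean_gap p x \<le> mean_gap q x"
    and "0 < x \<Longrightarrow> x \<le> 1 \<Longrightarrow> mean_gap q x \<le> mean_gap p x"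
proof -
  \<comment> \<open>Since \<open>l * (p - 1) = q - 1\<close>, the geometric mean of
    \<open>x powr (p - 1)\<close> and 1 with weights \<open>l\<close> and \<open>1 - l\<close> is
    \<open>x powr (q - 1)\<close>.\<close>
  define l where "l = (1 - q) / (1 - p)"
  define D where "D x = l * ((x powr p - 1) / p) + (1 - l) * (x - 1) - (x powr q - 1) / q" for x
  define D' where "D' x = l * x powr (p - 1) + (1 - l) - x powr (q - 1)" for x
  have l: "0 \<le> l" "l \<le> 1" "l * (p - 1) = q - 1"
    using pq by (auto simp: l_def field_simps)
  have gap: "mean_gap q x - mean_gap p x = D x / (1 - q)" for x
  proof -
    \<comment> \<open>Letters replace the powers here; the identity specific to this
      \<open>l\<close> is \<open>l / (1 - q) = 1 / (1 - p)\<close>.\<close>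
    have "(l * a + (1 - l) * y - b) / c = l / c * a + (1 / c - l / c) * y - 1 / c * b" for a b c y
      by (simp add: add_divide_distrib diff_divide_distrib left_diff_distrib)
    moreover have "l / (1 - q) = 1 / (1 - p)"
      using pq by (simp add: l_def)
    ultimately have "D x / (1 - q) = 1 / (1 - p) * ((x powr p - 1) / p)
        + (1 / (1 - q) - 1 / (1 - p)) * (x - 1) - 1 / (1 - q) * ((x powr q - 1) / q)"
      by (simp only: D_def)
    moreover have "mean_gap r x = 1 / (1 - r) * (x - 1) - 1 / (1 - r) * ((x powr r - 1) / r)"
      if "0 < r" "r < 1" for r
      using that by (simp add: mean_gap_def divide_simps) (simp add: algebra_simps)
    then have "mean_gap q x - mean_gap p x =
        (1 / (1 - q) * (x - 1) - 1 / (1 - q) * ((x powr q - 1) / q)) -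
        (1 / (1 - p) * (x - 1) - 1 / (1 - p) * ((x powr p - 1) / p))"
      using pq by simp
    moreover have "(c * y - c * b) - (d * y - d * a) = d * a + (c - d) * y - c * b"
      for a b c d y :: real
      by (simp add: algebra_simps)
    ultimately show ?thesis by (simp only:)
  qed
  have deriv: "(D has_real_derivative D' x) (at x)" if "x > 0" for x
    using that pq unfolding D_def D'_def
    by (auto intro!: derivative_eq_intros)
  have nonneg: "D' x \<ge> 0" if "x > 0" for x
  proof -
    define t where "t = (p - 1) * ln x"
    \<comment> \<open>Convexity of \<open>exp\<close> between 0 and \<open>(p - 1) * ln x\<close> is
      the weighted mean inequality in question.\<close>
    have "exp ((1 - l) *\<^sub>R 0 + l *\<^sub>R t) \<le> (1 - l) * exp 0 + l * exp t"
      by (rule convex_onD[OF exp_convex]) (use l in auto)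
    moreover have "l * t = (q - 1) * ln x" by (simp only: t_def l(3) flip: mult.assoc)
    then have "exp (l * t) = x powr (q - 1)" using that by (simp add: powr_def)
    moreover have "exp t = x powr (p - 1)" using that by (simp add: t_def powr_def)
    ultimately show ?thesis by (simp add: D'_def)
  qed
  have D: "D x \<le> D y" if "0 < x" "x \<le> y" for x y
  proof (rule DERIV_nonneg_imp_nondecreasing[OF \<open>x \<le> y\<close>])
    show "\<exists>d. (D has_real_derivative d) (at z) \<and> 0 \<le> d" if "x \<le> z" for z
      using deriv nonneg that \<open>0 < x\<close> by (meson less_le_trans)
  qed
  have "D 1 = 0" by (simp add: D_def)
  show "mean_gap p x \<le> mean_gap q x" if "x \<ge> 1"
  proof -
    have "0 \<le> D x / (1 - q)" using D[of 1 x] that \<open>D 1 = 0\<close> pq by simp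
    then show ?thesis unfolding gap[symmetric] by simp
  qed
  show "mean_gap q x \<le> mean_gap p x" if "0 < x" "x \<le> 1"
  proof -
    have "D x / (1 - q) \<le> 0" using D[of x 1] that \<open>D 1 = 0\<close> pq by (simp add: divide_nonpos_pos)
    then show ?thesis unfolding gap[symmetric] by simp
  qed
qed

lemma continuous_on_mean_gap: "0 \<notin> S \<Longrightarrow> continuous_on S (mean_gap r)"
  unfolding mean_gap_def divide_inverse by (intro continuous_intros) auto

section \<open>Operator powers and the operator form of \<open>mean_gap\<close>\<close>

context form_bounded_op
begin

lemma continuous_on_powr: "m > 0 \<Longrightarrow> continuous_on {m..M} (\<lambda>x. x powr r)"
  by (intro continuous_intros) auto

lemma powr_op_compose:
  assumes "m > 0"
  shows "powr_op T r o\<^sub>L powr_op T s = powr_op T (r + s)"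
proof -
  have "powr_op T r o\<^sub>L powr_op T s = fun_op (\<lambda>x. x powr r * x powr s) T"
    unfolding powr_op_def by (intro fun_op_mult[symmetric] continuous_on_powr assms)
  also have "\<dots> = powr_op T (r + s)"
    unfolding powr_op_def using assms by (intro fun_op_cong) (simp add: powr_add)
  finally show ?thesis .
qed

lemma powr_op_0: "m > 0 \<Longrightarrow> powr_op T 0 = id_blinfun"
  using fun_op_cong[of "\<lambda>x. x powr 0" "poly [:1:]"] fun_op_poly[of "[:1:]"]
  by (simp add: powr_op_def poly_op_const)

lemma powr_op_1: "m > 0 \<Longrightarrow> powr_op T 1 = T"
  using fun_op_cong[of "\<lambda>x. x powr 1" "poly [:0, 1:]"] fun_op_poly[of "[:0, 1:]"]
  by (simp add: powr_op_def poly_op_linear)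

lemma selfadjoint_op_powr_op: "m > 0 \<Longrightarrow> selfadjoint_op (powr_op T r)"
  unfolding powr_op_def by (intro selfadjoint_op_fun_op continuous_on_powr)

lemma fun_op_mean_gap:
  assumes "m > 0" "0 < r" "r < 1"
  shows "fun_op (mean_gap r) T =
    ((1 - r) *\<^sub>R id_blinfun + r *\<^sub>R T - powr_op T r) /\<^sub>R (r * (1 - r))"
proof -
  define k where "k = inverse (r * (1 - r))"
  have cont: "continuous_on {m..M} (poly Q)" for Q
    by (intro continuous_intros)
  \<comment> \<open>The scalar factor enters as the constant polynomial \<open>[:k:]\<close>, so
    that the rules for products, differences and polynomials suffice.\<close>
  have "fun_op (mean_gap r) T = fun_op (\<lambda>x. poly [:k:] x * (poly [:1 - r, r:] x - x powr r)) T"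
    by (rule fun_op_cong) (simp add: mean_gap_def k_def divide_inverse mult.commute)
  also have "\<dots> = poly_op [:k:] T o\<^sub>L (poly_op [:1 - r, r:] T - powr_op T r)"
    using assms(1)
    by (simp only: fun_op_mult fun_op_diff fun_op_poly powr_op_def cont continuous_on_powr
        continuous_on_diff)
  also have "\<dots> = ((1 - r) *\<^sub>R id_blinfun + r *\<^sub>R T - powr_op T r) /\<^sub>R (r * (1 - r))"
    by (rule blinfun_eqI) (simp add: poly_op_const poly_op_linear k_def blinfun.scaleR_left)
  finally show ?thesis .
qed

end

lemma positive_op_conjugate:
  assumes "selfadjoint_op S" "positive_op T"
  shows "positive_op (S o\<^sub>L T o\<^sub>L S)"
  using assms selfadjoint_op_inner[OF assms(1), of "T (S x)" x for x]
  by (simp add: positive_op_iff_inner selfadjoint_op_intros)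

theorem theorem4p2:
  fixes A B :: "'a::chilbert_space \<Rightarrow>\<^sub>L 'a" and u v p q :: real
  assumes "strictly_positive_op A" and "strictly_positive_op B"
    and "u > 0" and "v > 0"
    and "u *\<^sub>R A \<preceq> B" and "B \<preceq> v *\<^sub>R A"
    and "p \<in> {0<..<1}" and "q \<in> {0<..<1}" and "p \<le> q"
  shows "(v \<le> 1 \<longrightarrow>
            (arith_mean q A B - geom_mean q A B) /\<^sub>R (q * (1 - q)) \<preceq>
            (arith_mean p A B - geom_mean p A B) /\<^sub>R (p * (1 - p))) \<and>
         (u \<ge> 1 \<longrightarrow>
            (arith_mean p A B - geom_mean p A B) /\<^sub>R (p * (1 - p)) \<preceq>
            (arith_mean q A B - geom_mean q A B) /\<^sub>R (q * (1 - q)))"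
proof -
  have A: "selfadjoint_op A" and B: "selfadjoint_op B"
    using assms(1,2) by (auto simp: strictly_positive_op_def positive_op_iff_inner)
  obtain c where "c > 0" and c: "\<And>x. c * (norm x)\<^sup>2 \<le> inner (A x) x"
    using strictly_positive_op_coercive[OF assms(1)] by blast
  have "inner (A x) x \<le> norm A * (norm x)\<^sup>2" for x
  proof -
    have "inner (A x) x \<le> norm (A x) * norm x" by (rule norm_cauchy_schwarz)
    also have "\<dots> \<le> norm A * norm x * norm x" by (intro mult_right_mono norm_blinfun) simp
    finally show ?thesis by (simp add: power2_eq_square)
  qed
  then interpret A: form_bounded_op A c "norm A"
    using A c by unfold_locales
  define R where "R = powr_op A (1/2)"
  define Q where "Q = powr_op A (-1/2)"
  define C where "C = Q o\<^sub>L B o\<^sub>L Q"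
  have R: "selfadjoint_op R" and Q: "selfadjoint_op Q"
    using \<open>c > 0\<close> by (auto simp: R_def Q_def A.selfadjoint_op_powr_op)
  have "R o\<^sub>L R = A" "R o\<^sub>L Q = id_blinfun" "Q o\<^sub>L R = id_blinfun"
    using \<open>c > 0\<close> by (simp_all add: R_def Q_def A.powr_op_compose A.powr_op_0 A.powr_op_1)
  then have RR: "R (R x) = A x" and RQ: "R (Q x) = x" and QR: "Q (R x) = x" for x
    by (metis blinfun_apply_blinfun_compose blinfun_apply_id_blinfun)+
  \<comment> \<open>Evaluating \<open>u *\<^sub>R A \<preceq> B \<preceq> v *\<^sub>R A\<close> at
    \<open>Q x\<close> turns it into bounds \<open>u\<close> and \<open>v\<close> for the form of
    \<open>C\<close>.\<close>
  have C_form: "inner (C x) x = inner (B (Q x)) (Q x)" for x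
    by (simp add: C_def selfadjoint_op_inner[OF Q])
  have A_form: "inner (A (Q x)) (Q x) = (norm x)\<^sup>2" for x
    using selfadjoint_op_inner[OF R, of x "Q x"] RR[of "Q x"]
    by (simp add: RQ power2_norm_eq_inner)
  have "u * inner (A y) y \<le> inner (B y) y" "inner (B y) y \<le> v * inner (A y) y" for y
    using assms(5,6)
    by (auto simp: op_le_def positive_op_iff_inner blinfun.diff_left blinfun.scaleR_left
        inner_diff_left)
  then have "u * (norm x)\<^sup>2 \<le> inner (C x) x" "inner (C x) x \<le> v * (norm x)\<^sup>2" for x
    unfolding C_form by (metis A_form)+
  moreover have "selfadjoint_op C"
    unfolding C_def by (intro selfadjoint_op_intros Q B)
  ultimately interpret C: form_bounded_op C u v
    by unfold_locales
  have gap: "(arith_mean r A B - geom_mean r A B) /\<^sub>R (r * (1 - r))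
      = R o\<^sub>L fun_op (mean_gap r) C o\<^sub>L R" if "r \<in> {0<..<1}" for r
  proof -
    \<comment> \<open>Both \<open>A\<close> and \<open>B\<close> are conjugates by \<open>R\<close>,
      of the identity and of \<open>C\<close>, so \<open>R\<close> can be taken out of the
      arithmetic mean as well.\<close>
    have "B x = R (C (R x))" "A x = R (R x)" for x
      by (simp_all add: C_def RQ QR RR)
    moreover have "geom_mean r A B = R o\<^sub>L powr_op C r o\<^sub>L R"
      by (simp add: geom_mean_def R_def Q_def C_def)
    moreover have "fun_op (mean_gap r) C =
        ((1 - r) *\<^sub>R id_blinfun + r *\<^sub>R C - powr_op C r) /\<^sub>R (r * (1 - r))"
      using that \<open>u > 0\<close> by (intro C.fun_op_mean_gap) auto
    ultimately show ?thesis
      by (intro blinfun_eqI) (simp add: arith_mean_def blinfun.bilinear_simps)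
  qed
  have cont: "continuous_on {u..v} (mean_gap r)" for r
    using \<open>u > 0\<close> by (intro continuous_on_mean_gap) auto
  have le: "R o\<^sub>L fun_op (mean_gap r) C o\<^sub>L R \<preceq> R o\<^sub>L fun_op (mean_gap s) C o\<^sub>L R"
    if "\<And>x. x \<in> {u..v} \<Longrightarrow> mean_gap r x \<le> mean_gap s x" for r s
  proof -
    have "positive_op (fun_op (\<lambda>x. mean_gap s x - mean_gap r x) C)"
      using that by (intro C.positive_op_fun_op continuous_intros cont) auto
    then have "positive_op (R o\<^sub>L (fun_op (mean_gap s) C - fun_op (mean_gap r) C) o\<^sub>L R)"
      by (simp add: C.fun_op_diff cont positive_op_conjugate R)
    also have "R o\<^sub>L (fun_op (mean_gap s) C - fun_op (mean_gap r) C) o\<^sub>L R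
        = (R o\<^sub>L fun_op (mean_gap s) C o\<^sub>L R) - (R o\<^sub>L fun_op (mean_gap r) C o\<^sub>L R)"
      by (rule blinfun_eqI) (simp add: blinfun.bilinear_simps)
    finally show ?thesis
      by (simp add: op_le_def selfadjoint_op_intros R C.selfadjoint_op_fun_op cont)
  qed
  have pq: "0 < p" "p \<le> q" "q < 1" using assms(7-9) by auto
  \<comment> \<open>For \<open>v \<le> 1\<close> the interval \<open>{u..v}\<close> lies between 0
    and 1, for \<open>u \<ge> 1\<close> it lies above 1; each case uses one half of
    \<open>mean_gap_mono\<close>.\<close>
  show ?thesis
    unfolding gap[OF assms(7)] gap[OF assms(8)]
    using mean_gap_mono[OF pq] \<open>u > 0\<close> by (auto intro!: le)
qed

end
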